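(* Let $d\in\mathbf{N}$, $0\le r<1$, $0<\alpha<1$, and let $n$ be a positive integer with $n<\sqrt{\alpha\, 2^{d}(1-r^d)}$. Let $X_1,\ldots,X_n$ be points chosen randomly, independently and according to the uniform distribution on the spherical layer $B_d\setminus rB_d$, and let $A_n$ be the event that the set $M_n=\{X_1,\ldots,X_n\}$ is $1$-convex. Then $P(A_n)>1-\alpha$.
   Context: $B_d=\{x\in\mathbf{R}^d: |x|\le 1\}$ is the closed unit ball centered at the origin and $rB_d$ is the closed ball of radius $r$ centered at the origin. The uniform distribution on $B_d\setminus rB_d$ means $P(X\in S)=\mathrm{Vol}(S)/\mathrm{Vol}(B_d\setminus rB_d)$ for measurable $S\subseteq B_d\setminus rB_d$, where $\mathrm{Vol}$ is $d$-dimensional volume. A finite set $\{Y_1,\ldots,Y_k\}\subset\mathbf{R}^d$ is called $1$-convex if the set of vertices of its convex hull $\mathrm{conv}(Y_1,\ldots,Y_k)$ coincides with $\{Y_1,\ldots,Y_k\}$. *)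

theory Defs
  imports "HOL-Probability.Probability"
begin

definition spherical_layer :: "real \<Rightarrow> (real ^ 'd) set" where
  "spherical_layer r = cball 0 1 - cball 0 r"

(* The vertices of a polytope are its extreme points, i.e. its singleton faces
   (cf. face_of_singleton). The argument is the set of points, so repeated
   points count once. *)
definition one_convex :: "(real ^ 'd) set \<Rightarrow> bool" where
  "one_convex Y \<longleftrightarrow> finite Y \<and> {v. v extreme_point_of (convex hull Y)} = Y"

end

theory Submission
  imports Defs
begin

text \<open>
  If every \<open>X\<^sub>j\<close> satisfies \<open>X\<^sub>i \<bullet> X\<^sub>j < X\<^sub>j \<bullet> X\<^sub>j\<close> for all \<open>i \<noteq> j\<close>, then \<open>X\<^sub>j\<close> is exposed by the functional
  \<open>X\<^sub>j \<bullet> _\<close>, so the points are 1-convex. For a fixed \<open>x\<close> in the unit ball, the set of \<open>y\<close> violating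
  the inequality is the ball with diameter \<open>[0, x]\<close>, which by volume has probability at most
  \<open>1 / (2 ^ d * (1 - r ^ d))\<close> in the layer. A union bound over fewer than \<open>n\<^sup>2\<close> ordered pairs concludes.
\<close>

lemma notin_convex_hull_if_inner_less:
  assumes "\<And>z. z \<in> S \<Longrightarrow> a \<bullet> z < a \<bullet> y"
  shows "y \<notin> convex hull S"
proof
  assume "y \<in> convex hull S"
  moreover have "convex hull S \<subseteq> {z. a \<bullet> z < a \<bullet> y}"
    using assms by (intro hull_minimal convex_halfspace_lt) auto
  ultimately show False by auto
qed

text \<open>Extreme points of \<open>convex hull Y\<close> always lie in \<open>Y\<close>, so only
  points of \<open>Y\<close> need testing. Deleting an extreme point leaves a convex set, which must
  then contain the hull of the remaining points.\<close>

lemma one_convex_iff_notin_convex_hull: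
  "one_convex Y \<longleftrightarrow> finite Y \<and> (\<forall>y\<in>Y. y \<notin> convex hull (Y - {y}))"
proof (cases "finite Y")
  case True
  have "y extreme_point_of (convex hull Y) \<longleftrightarrow> y \<notin> convex hull (Y - {y})" if "y \<in> Y" for y
  proof
    assume "y extreme_point_of (convex hull Y)"
    then have "convex (convex hull Y - {y})"
      by (simp add: extreme_point_of_stillconvex)
    moreover have "Y - {y} \<subseteq> convex hull Y - {y}"
      using hull_subset[of Y convex] by auto
    ultimately have "convex hull (Y - {y}) \<subseteq> convex hull Y - {y}"
      by (rule hull_minimal[rotated])
    then show "y \<notin> convex hull (Y - {y})" by auto
  next
    assume "y \<notin> convex hull (Y - {y})"
    then show "y extreme_point_of (convex hull Y)"
      using extreme_point_of_convex_hull_insert[of "Y - {y}" y] True that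
      by (simp add: insert_absorb)
  qed
  then show ?thesis
    unfolding one_convex_def using True extreme_points_of_convex_hull[of Y] by auto
qed (simp add: one_convex_def)

text \<open>A functional that is strictly larger at \<open>y\<close> than at all other points keeps
  \<open>y\<close> out of their hull. It may vary with \<open>y\<close>; in the final argument it is
  \<open>y\<close> itself.\<close>

lemma one_convexI:
  assumes "finite Y" "\<And>y. y \<in> Y \<Longrightarrow> \<exists>a. \<forall>z\<in>Y - {y}. a \<bullet> z < a \<bullet> y"
  shows "one_convex Y"
  unfolding one_convex_iff_notin_convex_hull
  using assms notin_convex_hull_if_inner_less by blast

text \<open>Restricting the functionals to a countable dense set makes 1-convexity a measurable condition.\<close>

lemma one_convex_iff_dense:
  fixes Y :: "(real ^ 'd) set"
  assumes dense: "\<And>U :: (real ^ 'd) set. open U \<Longrightarrow> U \<noteq> {} \<Longrightarrow> \<exists>a\<in>D. a \<in> U"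
    and fin: "finite Y"
  shows "one_convex Y \<longleftrightarrow> (\<forall>y\<in>Y. \<exists>a\<in>D. \<forall>z\<in>Y - {y}. a \<bullet> z < a \<bullet> y)"
proof
  assume conv: "one_convex Y"
  show "\<forall>y\<in>Y. \<exists>a\<in>D. \<forall>z\<in>Y - {y}. a \<bullet> z < a \<bullet> y"
  proof
    fix y assume "y \<in> Y"
    then have "y \<notin> convex hull (Y - {y})"
      using conv by (simp add: one_convex_iff_notin_convex_hull)
    \<comment> \<open>The hull of a finite set is compact, hence closed, so \<open>y\<close> can be
      strictly separated from it.\<close>
    then obtain a b where ab: "a \<bullet> y < b" "\<And>z. z \<in> convex hull (Y - {y}) \<Longrightarrow> b < a \<bullet> z"
      using separating_hyperplane_closed_point[of "convex hull (Y - {y})" y] fin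
      by (auto simp: compact_imp_closed finite_imp_compact compact_convex_hull)
    \<comment> \<open>\<open>?U\<close> collects all functionals exposing \<open>y\<close>. It is
      open as a finite intersection of open half-spaces and contains \<open>- a\<close>; the sign
      flips because the separation puts \<open>y\<close> on the low side. Hence \<open>D\<close>
      meets it.\<close>
    let ?U = "\<Inter>z\<in>Y - {y}. {a. a \<bullet> z < a \<bullet> y}"
    have "open ?U"
      using fin by (intro open_INT ballI open_Collect_less continuous_intros) auto
    moreover have "- a \<in> ?U"
      using ab hull_subset[of "Y - {y}" convex] by force
    ultimately show "\<exists>a\<in>D. \<forall>z\<in>Y - {y}. a \<bullet> z < a \<bullet> y"
      using dense[of ?U] by blast
  qed
next
  assume "\<forall>y\<in>Y. \<exists>a\<in>D. \<forall>z\<in>Y - {y}. a \<bullet> z < a \<bullet> y"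
  then show "one_convex Y"
    using fin by (intro one_convexI) blast+
qed

text \<open>Since \<open>measure\<close> is 0 on non-measurable sets, a positive lower bound
  requires the event to be measurable. With functionals taken from a countable \<open>D\<close>, all
  quantifiers range over countable sets.\<close>

lemma measurable_one_convex_image:
  fixes X :: "'i \<Rightarrow> 'w \<Rightarrow> real ^ 'd"
  assumes fin: "finite I" and X: "\<And>i. i \<in> I \<Longrightarrow> X i \<in> borel_measurable M"
  shows "{\<omega> \<in> space M. one_convex ((\<lambda>i. X i \<omega>) ` I)} \<in> sets M"
proof -
  obtain D :: "(real ^ 'd) set" where D: "countable D"
    "\<And>U. open U \<Longrightarrow> U \<noteq> {} \<Longrightarrow> \<exists>a\<in>D. a \<in> U"
    by (rule countable_dense_setE) blast
  \<comment> \<open>Random points may coincide, so removing the value \<open>X j \<omega>\<close>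
    from the image turns into the disjunct \<open>X i \<omega> = X j \<omega>\<close>, not into
    \<open>i \<noteq> j\<close>.\<close>
  have ball_image: "(\<forall>z\<in>(\<lambda>i. X i \<omega>) ` I - {X j \<omega>}. a \<bullet> z < a \<bullet> X j \<omega>) \<longleftrightarrow>
      (\<forall>i\<in>I. X i \<omega> = X j \<omega> \<or> a \<bullet> X i \<omega> < a \<bullet> X j \<omega>)" for \<omega> j a
    by auto
  have "one_convex ((\<lambda>i. X i \<omega>) ` I) \<longleftrightarrow>
      (\<forall>j\<in>I. \<exists>a\<in>D. \<forall>i\<in>I. X i \<omega> = X j \<omega> \<or> a \<bullet> X i \<omega> < a \<bullet> X j \<omega>)" for \<omega>
  proof -
    have "one_convex ((\<lambda>i. X i \<omega>) ` I) \<longleftrightarrow>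
        (\<forall>y\<in>(\<lambda>i. X i \<omega>) ` I. \<exists>a\<in>D. \<forall>z\<in>(\<lambda>i. X i \<omega>) ` I - {y}. a \<bullet> z < a \<bullet> y)"
      using fin by (intro one_convex_iff_dense D(2)) auto
    also have "\<dots> \<longleftrightarrow>
        (\<forall>j\<in>I. \<exists>a\<in>D. \<forall>z\<in>(\<lambda>i. X i \<omega>) ` I - {X j \<omega>}. a \<bullet> z < a \<bullet> X j \<omega>)"
      by blast
    finally show ?thesis unfolding ball_image .
  qed
  then have "{\<omega> \<in> space M. one_convex ((\<lambda>i. X i \<omega>) ` I)} =
      {\<omega> \<in> space M. \<forall>j\<in>I. \<exists>a\<in>D. \<forall>i\<in>I. X i \<omega> = X j \<omega> \<or> a \<bullet> X i \<omega> < a \<bullet> X j \<omega>}"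
    by simp
  also have "\<dots> \<in> sets M"
    using fin X D(1)
    by (intro sets.sets_Collect_finite_All sets.sets_Collect_countable_Ex'
        sets.sets_Collect_disj borel_measurable_eq borel_measurable_less
        borel_measurable_inner borel_measurable_const) auto
  finally show ?thesis .
qed

text \<open>Complete the square. This is the theorem of Thales: the ball with diameter from 0 to
  \<open>x\<close> consists of 0, \<open>x\<close> and the points that see this segment at a right
  or obtuse angle.\<close>

lemma inner_ge_inner_self_iff_cball:
  fixes x y :: "'a::real_inner"
  shows "y \<bullet> y \<le> x \<bullet> y \<longleftrightarrow> y \<in> cball (x /\<^sub>R 2) (norm x / 2)"
proof -
  have "y \<in> cball (x /\<^sub>R 2) (norm x / 2) \<longleftrightarrow> (norm (x /\<^sub>R 2 - y))\<^sup>2 \<le> (norm x / 2)\<^sup>2"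
    unfolding mem_cball dist_norm by (subst power2_le_iff_abs_le) auto
  also have "\<dots> \<longleftrightarrow> y \<bullet> y \<le> x \<bullet> y"
    by (auto simp: power2_norm_eq_inner power_divide inner_diff inner_commute field_simps)
  finally show ?thesis by simp
qed

lemma sets_spherical_layer [measurable]: "spherical_layer r \<in> sets borel"
  by (simp add: spherical_layer_def)

lemma emeasure_spherical_layer:
  assumes "0 \<le> r" "r \<le> 1"
  shows "emeasure lborel (spherical_layer r :: (real ^ 'd) set) =
    ennreal (unit_ball_vol CARD('d) * (1 - r ^ CARD('d)))"
proof -
  have "emeasure lborel (spherical_layer r :: (real ^ 'd) set) =
    emeasure lborel (cball 0 1 :: (real ^ 'd) set) - emeasure lborel (cball 0 r :: (real ^ 'd) set)"
    unfolding spherical_layer_def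
    using assms by (intro emeasure_Diff) (auto simp: emeasure_cball)
  also have "\<dots> = ennreal (unit_ball_vol CARD('d) * (1 - r ^ CARD('d)))"
    using assms by (simp add: emeasure_cball ennreal_minus algebra_simps)
  finally show ?thesis .
qed

text \<open>The ball has radius at most 1/2, so its volume is at most the fraction
  \<open>1 / 2 ^ d\<close> of the unit ball, where \<open>d\<close> is the dimension; the layer has
  the fraction \<open>1 - r ^ d\<close>.\<close>

lemma emeasure_uniform_layer_thales_ball:
  fixes x :: "real ^ 'd"
  assumes r: "0 \<le> r" "r < 1" and x: "norm x \<le> 1"
  shows "emeasure (uniform_measure lborel (spherical_layer r)) {y. y \<bullet> y \<le> x \<bullet> y}
    \<le> ennreal (1 / (2 ^ CARD('d) * (1 - r ^ CARD('d))))"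
proof -
  let ?d = "CARD('d)"
  let ?B = "cball (x /\<^sub>R 2) (norm x / 2)"
  let ?v = "unit_ball_vol (real ?d)"
  have v: "?v > 0" by simp
  have p: "1 - r ^ ?d > 0"
    using r by (simp add: power_less_one_iff)
  have "emeasure (uniform_measure lborel (spherical_layer r)) {y. y \<bullet> y \<le> x \<bullet> y}
      = emeasure lborel (spherical_layer r \<inter> ?B) / emeasure lborel (spherical_layer r :: (real ^ 'd) set)"
    unfolding inner_ge_inner_self_iff_cball Collect_mem_eq by simp
  \<comment> \<open>Counting the whole ball avoids computing its overlap with the removed
    core.\<close>
  also have "\<dots> \<le> emeasure lborel ?B / emeasure lborel (spherical_layer r :: (real ^ 'd) set)"
    by (intro divide_right_mono_ennreal emeasure_mono) auto
  also have "\<dots> = ennreal (?v * (norm x / 2) ^ ?d / (?v * (1 - r ^ ?d)))"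
    using r v p by (simp add: emeasure_spherical_layer emeasure_cball divide_ennreal)
  also have "\<dots> \<le> ennreal (?v * (1 / 2) ^ ?d / (?v * (1 - r ^ ?d)))"
    using x v p by (intro ennreal_leI divide_right_mono mult_left_mono power_mono) auto
  also have "\<dots> = ennreal (1 / (2 ^ ?d * (1 - r ^ ?d)))"
    by (simp add: power_divide v[THEN less_imp_neq, symmetric])
  finally show ?thesis .
qed

text \<open>Restrict the family to the disjoint index sets \<open>{i}\<close> and
  \<open>{j}\<close>, then evaluate the restrictions at \<open>i\<close> and
  \<open>j\<close>.\<close>

lemma (in prob_space) indep_var_of_indep_vars:
  assumes ind: "indep_vars M' X I" and ij: "i \<in> I" "j \<in> I" "i \<noteq> j"
  shows "indep_var (M' i) (X i) (M' j) (X j)"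
proof -
  have "indep_var (PiM {i} M') (\<lambda>\<omega>. restrict (\<lambda>k. X k \<omega>) {i}) (PiM {j} M') (\<lambda>\<omega>. restrict (\<lambda>k. X k \<omega>) {j})"
    using ij by (intro indep_var_restrict[OF ind]) auto
  then have "indep_var (M' i) ((\<lambda>f. f i) \<circ> (\<lambda>\<omega>. restrict (\<lambda>k. X k \<omega>) {i}))
      (M' j) ((\<lambda>f. f j) \<circ> (\<lambda>\<omega>. restrict (\<lambda>k. X k \<omega>) {j}))"
    by (rule indep_var_compose) auto
  then show ?thesis by (simp add: comp_def)
qed

text \<open>By independence the joint law of \<open>U\<close> and \<open>V\<close> is a product, so
  Fubini reduces the claim to the bound for a fixed value \<open>x\<close> of
  \<open>U\<close>.\<close>

lemma (in prob_space) prob_thales_ball_le: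
  fixes U V :: "'a \<Rightarrow> real ^ 'd"
  assumes r: "0 \<le> r" "r < 1"
    and ind: "indep_var borel U borel V"
    and U: "distr M borel U = uniform_measure lborel (spherical_layer r)"
    and V: "distr M borel V = uniform_measure lborel (spherical_layer r)"
  shows "prob {\<omega> \<in> space M. V \<omega> \<bullet> V \<omega> \<le> U \<omega> \<bullet> V \<omega>} \<le> 1 / (2 ^ CARD('d) * (1 - r ^ CARD('d)))"
proof -
  let ?N = "uniform_measure lborel (spherical_layer r) :: (real ^ 'd) measure"
  let ?p = "1 / (2 ^ CARD('d) * (1 - r ^ CARD('d)))"
  let ?S = "{z :: (real ^ 'd) \<times> (real ^ 'd). snd z \<bullet> snd z \<le> fst z \<bullet> snd z}"
  have [measurable]: "U \<in> borel_measurable M" "V \<in> borel_measurable M"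
    using ind indep_var_rv1 indep_var_rv2 by blast+
  have p: "0 \<le> ?p"
    using r by (simp add: power_le_one)
  interpret N: prob_space ?N
    unfolding U[symmetric] by (rule prob_space_distr) measurable
  have setsN: "sets ?N = sets borel" by simp
  have S: "?S \<in> sets (borel \<Otimes>\<^sub>M borel)"
    unfolding borel_prod
    by (intro borel_closed closed_Collect_le continuous_intros)
  have S': "?S \<in> sets (?N \<Otimes>\<^sub>M ?N)"
    using S sets_pair_measure_cong[OF setsN setsN] by blast
  have "emeasure M {\<omega> \<in> space M. V \<omega> \<bullet> V \<omega> \<le> U \<omega> \<bullet> V \<omega>}
      = emeasure (distr M (borel \<Otimes>\<^sub>M borel) (\<lambda>\<omega>. (U \<omega>, V \<omega>))) ?S"
    using S by (subst emeasure_distr) (auto intro!: arg_cong[where f = "emeasure M"])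
  also have "distr M (borel \<Otimes>\<^sub>M borel) (\<lambda>\<omega>. (U \<omega>, V \<omega>)) = ?N \<Otimes>\<^sub>M ?N"
    using ind U V by (simp add: indep_var_distribution_eq)
  also have "emeasure (?N \<Otimes>\<^sub>M ?N) ?S = (\<integral>\<^sup>+x. emeasure ?N {y. y \<bullet> y \<le> x \<bullet> y} \<partial>?N)"
    by (subst N.emeasure_pair_measure_alt[OF S']) (simp add: vimage_def)
  also have "\<dots> \<le> (\<integral>\<^sup>+x. ennreal ?p \<partial>?N)"
  \<comment> \<open>The bound on the sections needs \<open>norm x \<le> 1\<close>, which holds only
    almost everywhere, namely on the layer.\<close>
  proof (intro nn_integral_mono_AE AE_uniform_measureI AE_I2 impI)
    fix x :: "real ^ 'd" assume "x \<in> spherical_layer r"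
    then have "norm x \<le> 1" by (simp add: spherical_layer_def)
    then show "emeasure ?N {y. y \<bullet> y \<le> x \<bullet> y} \<le> ennreal ?p"
      by (rule emeasure_uniform_layer_thales_ball[OF r])
  qed simp
  also have "\<dots> = ennreal ?p"
    using N.emeasure_space_1 by simp
  finally show ?thesis
    using p by (simp add: emeasure_eq_measure)
qed

theorem theorem1:
  fixes M :: "'w measure"
    and X :: "nat \<Rightarrow> 'w \<Rightarrow> real ^ 'd"
    and r \<alpha> :: real
    and n :: nat
  assumes "0 \<le> r" and "r < 1"
    and "0 < \<alpha>" and "\<alpha> < 1"
    and "1 \<le> n"
    and "real n < sqrt (\<alpha> * 2 ^ CARD('d) * (1 - r ^ CARD('d)))"
    and "prob_space M"
    and "prob_space.indep_vars M (\<lambda>_. borel) X {1..n}"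
    and "\<And>i. i \<in> {1..n} \<Longrightarrow>
           distr M borel (X i) = uniform_measure lborel (spherical_layer r)"
  shows "measure M {\<omega> \<in> space M. one_convex ((\<lambda>i. X i \<omega>) ` {1..n})} > 1 - \<alpha>"
proof -
  interpret prob_space M by fact
  let ?c = "2 ^ CARD('d) * (1 - r ^ CARD('d))"
  let ?P = "{(i, j). i \<in> {1..n} \<and> j \<in> {1..n} \<and> i \<noteq> j}"
  let ?A = "{\<omega> \<in> space M. one_convex ((\<lambda>i. X i \<omega>) ` {1..n})}"
  \<comment> \<open>The bad event is not symmetric in \<open>i\<close> and \<open>j\<close>, hence
    the ordered pairs in \<open>?P\<close>.\<close>
  define B where "B = (\<lambda>(i, j). {\<omega> \<in> space M. X j \<omega> \<bullet> X j \<omega> \<le> X i \<omega> \<bullet> X j \<omega>})"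
  have X: "X i \<in> borel_measurable M" if "i \<in> {1..n}" for i
    using assms(8) that by (auto simp: indep_vars_def)
  have A: "?A \<in> events"
    by (rule measurable_one_convex_image) (auto intro: X)
  have c: "0 < ?c"
    using assms(1,2) by (simp add: power_less_one_iff)
  have P: "?P \<subseteq> {1..n} \<times> {1..n}" by auto
  then have finP: "finite ?P" by (rule finite_subset) simp
  have cardP: "card ?P \<le> n * n"
    using card_mono[OF _ P] by simp
  have B: "B p \<in> events" if "p \<in> ?P" for p
    using that X unfolding B_def
    by (auto intro!: borel_measurable_le borel_measurable_inner)
  have probB: "prob (B p) \<le> 1 / ?c" if "p \<in> ?P" for p
    using that assms(1,2,8,9) unfolding B_def
    by (auto intro!: prob_thales_ball_le indep_var_of_indep_vars[where M' = "\<lambda>_. borel"])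
  \<comment> \<open>The strictness of the final inequality comes from here; all the probability
    estimates are weak.\<close>
  have "(real n)\<^sup>2 < \<alpha> * ?c"
    using assms(6) by (metis of_nat_0_le_iff real_less_rsqrt real_sqrt_less_iff real_sqrt_abs abs_of_nonneg mult.assoc)
  then have n: "real (n * n) * (1 / ?c) < \<alpha>"
    using c by (simp add: divide_less_eq power2_eq_square)
  have sub: "space M - (\<Union>p\<in>?P. B p) \<subseteq> ?A"
  proof
    fix \<omega> assume \<omega>: "\<omega> \<in> space M - (\<Union>p\<in>?P. B p)"
    \<comment> \<open>Outside the bad events \<open>X j \<omega>\<close> serves as its own exposing
      functional. Coinciding points with distinct indices would give equality, so they are excluded
      too.\<close>
    have "X j \<omega> \<bullet> X i \<omega> < X j \<omega> \<bullet> X j \<omega>" if "i \<in> {1..n}" "j \<in> {1..n}" "i \<noteq> j" for i j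
      using \<omega> that unfolding B_def by (force simp: inner_commute)
    then have "one_convex ((\<lambda>i. X i \<omega>) ` {1..n})"
      by (intro one_convexI) (simp, blast)
    then show "\<omega> \<in> ?A" using \<omega> by simp
  qed
  have UB: "(\<Union>p\<in>?P. B p) \<in> events"
    using B finP by (intro sets.finite_UN) auto
  have "prob (\<Union>p\<in>?P. B p) \<le> (\<Sum>p\<in>?P. prob (B p))"
    using B finP by (intro measure_UNION_le) auto
  also have "\<dots> \<le> real (card ?P) * (1 / ?c)"
    using probB by (intro sum_bounded_above) auto
  also have "\<dots> \<le> real (n * n) * (1 / ?c)"
    using cardP c by (intro mult_right_mono of_nat_mono) auto
  also note n
  finally have "1 - \<alpha> < prob (space M - (\<Union>p\<in>?P. B p))"
    using prob_compl[OF UB] by simp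
  also have "\<dots> \<le> prob ?A"
    using sub A by (rule finite_measure_mono)
  finally show ?thesis .
qed

end
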